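(* For each positive integer $n$, the polynomial $p_n(z;x,y)=\prod_{w\in\mathrm{inv}(x)\ast\mathrm{inv}(y)}(z-w)$, where $\ast$ and $\mathrm{inv}$ are the operations of the $n$-valued group $\mathbb{G}_n$, has the following properties: (i) $p_n(z;x,y)$ is symmetric in the variables $x,y,z$. (ii) For all complex $x,y,z$, $$p_n(z^n;x,y)=\chi\bigl(F_n((-1)^{n+1}x)\boxplus F_n((-1)^{n+1}y);\,z\bigr).$$ (iii) $p_n(z;x,y)$ is a homogeneous polynomial in $x,y,z$ of degree $n$ with integer coefficients.
   Context: $\mathbb{G}_n$ is $\mathbb{C}$ with the $n$-valued multiplication $x\ast y=[(\sqrt[n]{x}+\epsilon^r\sqrt[n]{y})^n\mid r=1,\dots,n]$ (an $n$-multiset), where $\epsilon$ is a primitive $n$-th root of unity and $\sqrt[n]{\cdot}$ a fixed branch of the root; identity $0$, inverse $\mathrm{inv}(x)=(-1)^nx$. The product defining $p_n$ runs over the $n$-multiset. $F_n(a)$ denotes the $n\times n$ Frobenius companion matrix of $t^n+a$: $1$'s on the subdiagonal, top-right entry $-a$, all other entries $0$ (for $n=1$ it is the $1\times1$ matrix $(-a)$). For square matrices $A$ of order $p$ and $B$ of order $q$, the Kronecker sum is $A\boxplus B=A\otimes I_q+I_p\otimes B$. $\chi(M;z)=\det(zI-M)$. *)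

theory Defs
  imports Complex_Main "HOL-Library.Multiset" "Jordan_Normal_Form.Char_Poly"
begin

definition primitive_root_of_unity :: "nat \<Rightarrow> complex \<Rightarrow> bool" where
  "primitive_root_of_unity n \<epsilon> \<longleftrightarrow> \<epsilon> ^ n = 1 \<and> (\<forall>k. 0 < k \<and> k < n \<longrightarrow> \<epsilon> ^ k \<noteq> 1)"

text \<open>A single-valued choice of the \<open>n\<close>-th root on all of the complex plane. No continuity is
  required, so the principal branch, and any other branch of the root, is an instance.\<close>

definition root_branch :: "nat \<Rightarrow> (complex \<Rightarrow> complex) \<Rightarrow> bool" where
  "root_branch n \<rho> \<longleftrightarrow> (\<forall>x. \<rho> x ^ n = x)"

definition nv_mult :: "nat \<Rightarrow> complex \<Rightarrow> (complex \<Rightarrow> complex) \<Rightarrow> complex \<Rightarrow> complex \<Rightarrow> complex multiset" where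
  "nv_mult n \<epsilon> \<rho> x y = image_mset (\<lambda>r. (\<rho> x + \<epsilon> ^ r * \<rho> y) ^ n) (mset_set {1..n})"

definition nv_inv :: "nat \<Rightarrow> complex \<Rightarrow> complex" where
  "nv_inv n x = (-1) ^ n * x"

text \<open>The argument order after \<open>n\<close>, \<open>\<epsilon>\<close>, \<open>\<rho>\<close> is that of \<open>p\<^sub>n(z; x, y)\<close>.\<close>

definition nv_poly :: "nat \<Rightarrow> complex \<Rightarrow> (complex \<Rightarrow> complex) \<Rightarrow> complex \<Rightarrow> complex \<Rightarrow> complex \<Rightarrow> complex" where
  "nv_poly n \<epsilon> \<rho> z x y = (\<Prod>w \<in># nv_mult n \<epsilon> \<rho> (nv_inv n x) (nv_inv n y). z - w)"

definition symmetric3 :: "('a \<Rightarrow> 'a \<Rightarrow> 'a \<Rightarrow> 'b) \<Rightarrow> bool" where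
  "symmetric3 f \<longleftrightarrow> (\<forall>a b c.
     f a b c = f a c b \<and> f a b c = f b a c \<and> f a b c = f b c a \<and>
     f a b c = f c a b \<and> f a b c = f c b a)"

text \<open>Polynomials in three variables over the (infinite) complex field are identified with their
  evaluation functions; the coefficients are then determined by the function. Requiring a nonzero
  coefficient excludes the zero polynomial, so that the degree is exactly \<open>d\<close>.\<close>

definition homogeneous_int_poly3 :: "nat \<Rightarrow> (complex \<Rightarrow> complex \<Rightarrow> complex \<Rightarrow> complex) \<Rightarrow> bool" where
  "homogeneous_int_poly3 d f \<longleftrightarrow> (\<exists>c :: nat \<Rightarrow> nat \<Rightarrow> nat \<Rightarrow> int.
     (\<exists>i j k. i + j + k = d \<and> c i j k \<noteq> 0) \<and>
     (\<forall>x y z. f x y z =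
        (\<Sum>(i, j, k) \<in> {(i, j, k). i + j + k = d}. of_int (c i j k) * x ^ i * y ^ j * z ^ k)))"

text \<open>The companion matrix of \<open>t\<^sup>n + a\<close>. The top-right entry is tested first; for \<open>n = 1\<close> it is
  the only entry.\<close>

definition frobenius_mat :: "nat \<Rightarrow> 'a :: comm_ring_1 \<Rightarrow> 'a mat" where
  "frobenius_mat n a = mat n n (\<lambda>(i, j).
     if i = 0 \<and> j = n - 1 then - a else if i = j + 1 then 1 else 0)"

definition kronecker_prod :: "'a :: semiring_1 mat \<Rightarrow> 'a mat \<Rightarrow> 'a mat" where
  "kronecker_prod A B = mat (dim_row A * dim_row B) (dim_col A * dim_col B) (\<lambda>(i, j).
     A $$ (i div dim_row B, j div dim_col B) * B $$ (i mod dim_row B, j mod dim_col B))"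

definition kronecker_sum :: "'a :: semiring_1 mat \<Rightarrow> 'a mat \<Rightarrow> 'a mat" where
  "kronecker_sum A B = kronecker_prod A (1\<^sub>m (dim_row B)) + kronecker_prod (1\<^sub>m (dim_row A)) B"

end

theory Submission
  imports Defs "Jordan_Normal_Form.Schur_Decomposition"
begin

text \<open>Choose \<open>u, a, b\<close> with \<open>u ^ n = z\<close>, \<open>a ^ n = (-1) ^ n * x\<close> and \<open>b ^ n = (-1) ^ n * y\<close>. Factoring each
  \<open>u ^ n - w\<close> over the \<open>n\<close>-th roots of unity turns \<open>p\<^sub>n(z; x, y)\<close> into the double product of the
  \<open>u - \<epsilon> ^ r * a - \<epsilon> ^ s * b\<close>, which does not depend on the chosen roots. Exchanging \<open>a\<close> with \<open>b\<close>,
  or \<open>u\<close> with \<open>- a\<close>, permutes the factors up to signs and roots of unity that cancel, and scaling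
  \<open>u, a, b\<close> gives homogeneity. The numbers \<open>\<epsilon> ^ r * a\<close> are the eigenvalues of the first
  companion matrix; after triangularising both matrices, the eigenvalues of a Kronecker sum are seen to be the
  sums of eigenvalues. As this characteristic polynomial can be formed over the integral polynomials in
  \<open>x\<close> and \<open>y\<close>, the coefficients are integers; invariance under \<open>u \<mapsto> \<epsilon> * u\<close> leaves only powers of
  \<open>u ^ n\<close>.\<close>

section \<open>Products over roots of unity\<close>

lemma primitive_root_of_unity_inj:
  assumes "primitive_root_of_unity n \<epsilon>"
  shows "inj_on (\<lambda>s. \<epsilon> ^ s) {1..n}"
proof (rule linorder_inj_onI)
  fix r s assume "r < s" "r \<in> {1..n}" "s \<in> {1..n}"
  have "\<epsilon> \<noteq> 0"
    using assms \<open>r < s\<close> \<open>s \<in> {1..n}\<close> by (auto simp: primitive_root_of_unity_def power_0_left)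
  moreover have "\<epsilon> ^ (s - r) \<noteq> 1"
    using assms \<open>r < s\<close> \<open>s \<in> {1..n}\<close> \<open>r \<in> {1..n}\<close> by (auto simp: primitive_root_of_unity_def)
  moreover have "\<epsilon> ^ s = \<epsilon> ^ r * \<epsilon> ^ (s - r)"
    using \<open>r < s\<close> by (simp flip: power_add)
  ultimately show "\<epsilon> ^ r \<noteq> \<epsilon> ^ s" by (metis mult_cancel_left2 power_not_zero)
qed (rule nat_le_linear)

text \<open>Both sides are monic of degree \<open>n\<close> and agree at the points
  \<open>\<epsilon> ^ s * v\<close>. By primitivity these are \<open>n\<close> distinct points
  unless \<open>v = 0\<close>, in which case both sides are the \<open>n\<close>-th power of the
  variable.\<close>

lemma monom_minus_const_factorization:
  assumes "n > 0" and "primitive_root_of_unity n \<epsilon>"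
  shows "monom 1 n - [:v ^ n:] = (\<Prod>s\<in>{1..n}. [:- (\<epsilon> ^ s * v), 1:])"
proof (cases "v = 0")
  case True
  have "(\<Prod>s\<in>{1..n}. [:- (\<epsilon> ^ s * v), 1:]) = [:0, 1:] ^ n"
    by (simp only: True mult_zero_right minus_zero prod_constant card_atLeastAtMost) simp
  also have "\<dots> = monom 1 n"
    by (metis monom_altdef smult_1_left)
  finally show ?thesis using assms(1) True by (simp add: power_0_left)
next
  case False
  define A where "A = (\<lambda>s. \<epsilon> ^ s * v) ` {1..n}"
  have "inj_on (\<lambda>s. \<epsilon> ^ s * v) {1..n}"
    using False primitive_root_of_unity_inj[OF assms(2)]
    by (intro inj_onI) (metis inj_onD mult_cancel_right)
  then have card: "card A = n"
    unfolding A_def by (simp add: card_image)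
  have deg: "degree (\<Prod>s\<in>{1..n}. [:- (\<epsilon> ^ s * v), 1:]) = n"
    by (subst degree_prod_eq_sum_degree) auto
  have lc: "lead_coeff (\<Prod>s\<in>{1..n}. [:- (\<epsilon> ^ s * v), 1:]) = 1"
    by (subst lead_coeff_prod) auto
  show ?thesis
  proof (rule poly_eqI_degree_lead_coeff[where A = A and n = n])
    show "degree (monom 1 n - [:v ^ n:]) \<le> n"
      by (intro degree_diff_le degree_monom_le) auto
    show "coeff (monom 1 n - [:v ^ n:]) n = coeff (\<Prod>s\<in>{1..n}. [:- (\<epsilon> ^ s * v), 1:]) n"
      using lc deg assms(1) by (simp add: coeff_pCons split: nat.splits)
  next
    fix x assume "x \<in> A"
    then obtain s where s: "s \<in> {1..n}" "x = \<epsilon> ^ s * v" by (auto simp: A_def)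
    have "x ^ n = (\<epsilon> ^ n) ^ s * v ^ n"
      by (simp add: s power_mult_distrib flip: power_mult) (simp add: mult.commute)
    then have "x ^ n = v ^ n" using assms(2) by (simp add: primitive_root_of_unity_def)
    moreover have "poly (\<Prod>s\<in>{1..n}. [:- (\<epsilon> ^ s * v), 1:]) x = 0"
      using s by (auto simp: poly_prod)
    ultimately show "poly (monom 1 n - [:v ^ n:]) x = poly (\<Prod>s\<in>{1..n}. [:- (\<epsilon> ^ s * v), 1:]) x"
      by (simp add: poly_monom)
  qed (use card deg in auto)
qed

lemma diff_power_factorization:
  assumes "n > 0" and "primitive_root_of_unity n \<epsilon>"
  shows "u ^ n - v ^ n = (\<Prod>s\<in>{1..n}. u - \<epsilon> ^ s * v)"
  using arg_cong[OF monom_minus_const_factorization[OF assms, of v], of "\<lambda>p. poly p u"]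
  by (simp add: poly_monom poly_prod)

section \<open>The double product over pairs of roots\<close>

lemma nv_poly_altdef:
  "nv_poly n \<epsilon> \<rho> z x y =
    (\<Prod>r\<in>{1..n}. z - (\<rho> ((-1) ^ n * x) + \<epsilon> ^ r * \<rho> ((-1) ^ n * y)) ^ n)"
  by (simp add: nv_poly_def nv_mult_def nv_inv_def image_mset.compositionality comp_def
      flip: prod_unfold_prod_mset)

lemma double_product_factorization:
  assumes "n > 0" and "primitive_root_of_unity n \<epsilon>"
  shows "(\<Prod>r\<in>{1..n}. \<Prod>s\<in>{1..n}. u - \<epsilon> ^ r * a - \<epsilon> ^ s * b) =
    (\<Prod>r\<in>{1..n}. (u - \<epsilon> ^ r * a) ^ n - b ^ n)"
  by (simp only: diff_power_factorization[OF assms])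

text \<open>By \<open>double_product_factorization\<close>, the double product involves
  \<open>b\<close> only through \<open>b ^ n\<close>. Exchanging the order of the products gives the
  same for \<open>a\<close>.\<close>

lemma double_product_cong:
  assumes "n > 0" and "primitive_root_of_unity n \<epsilon>"
    and "a ^ n = a' ^ n" and "b ^ n = b' ^ n"
  shows "(\<Prod>r\<in>{1..n}. \<Prod>s\<in>{1..n}. u - \<epsilon> ^ r * a - \<epsilon> ^ s * b) =
    (\<Prod>r\<in>{1..n}. \<Prod>s\<in>{1..n}. u - \<epsilon> ^ r * a' - \<epsilon> ^ s * b')"
proof -
  have swap: "(\<Prod>r\<in>{1..n}. \<Prod>s\<in>{1..n}. u - \<epsilon> ^ r * c - \<epsilon> ^ s * d) =
      (\<Prod>r\<in>{1..n}. \<Prod>s\<in>{1..n}. u - \<epsilon> ^ r * d - \<epsilon> ^ s * c)" for c d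
    by (subst prod.swap) (simp add: algebra_simps)
  have "(\<Prod>r\<in>{1..n}. \<Prod>s\<in>{1..n}. u - \<epsilon> ^ r * a - \<epsilon> ^ s * b) =
      (\<Prod>r\<in>{1..n}. \<Prod>s\<in>{1..n}. u - \<epsilon> ^ r * a - \<epsilon> ^ s * b')"
    by (simp only: double_product_factorization[OF assms(1,2)] assms(4))
  also have "\<dots> = (\<Prod>r\<in>{1..n}. \<Prod>s\<in>{1..n}. u - \<epsilon> ^ r * a' - \<epsilon> ^ s * b')"
    by (subst (1 2) swap) (simp only: double_product_factorization[OF assms(1,2)] assms(3))
  finally show ?thesis .
qed

text \<open>Each factor of \<open>nv_poly\<close> splits into \<open>n\<close> linear factors in
  \<open>u\<close>. The roots \<open>u\<close>, \<open>a\<close>, \<open>b\<close> are arbitrary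
  rather than values of \<open>\<rho>\<close>; the symmetry and scaling arguments rely on this
  freedom.\<close>

lemma nv_poly_double_product:
  assumes "n > 0" and "primitive_root_of_unity n \<epsilon>" and "root_branch n \<rho>"
    and z: "u ^ n = z" and x: "a ^ n = (-1) ^ n * x" and y: "b ^ n = (-1) ^ n * y"
  shows "nv_poly n \<epsilon> \<rho> z x y = (\<Prod>r\<in>{1..n}. \<Prod>s\<in>{1..n}. u - \<epsilon> ^ r * a - \<epsilon> ^ s * b)"
proof -
  define a' b' where "a' = \<rho> ((-1) ^ n * x)" and "b' = \<rho> ((-1) ^ n * y)"
  have a': "a ^ n = a' ^ n" and b': "b ^ n = b' ^ n"
    using assms(3) x y by (simp_all add: a'_def b'_def root_branch_def)
  have pow: "(\<epsilon> ^ s * b') ^ n = b' ^ n" for s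
  proof -
    have "(\<epsilon> ^ s * b') ^ n = (\<epsilon> ^ n) ^ s * b' ^ n"
      by (simp add: power_mult_distrib flip: power_mult) (simp add: mult.commute)
    then show ?thesis using assms(2) by (simp add: primitive_root_of_unity_def)
  qed
  have "nv_poly n \<epsilon> \<rho> z x y = (\<Prod>r\<in>{1..n}. \<Prod>s\<in>{1..n}. u - \<epsilon> ^ s * (a' + \<epsilon> ^ r * b'))"
    unfolding nv_poly_altdef a'_def b'_def
    by (simp only: z[symmetric] diff_power_factorization[OF assms(1,2)])
  also have "\<dots> = (\<Prod>s\<in>{1..n}. \<Prod>r\<in>{1..n}. (u - \<epsilon> ^ s * a') - \<epsilon> ^ r * (\<epsilon> ^ s * b'))"
    by (subst prod.swap) (simp add: algebra_simps)
  \<comment> \<open>For fixed \<open>s\<close>, the factor \<open>\<epsilon> ^ s\<close> in front of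
    \<open>b'\<close> is absorbed: either way the inner product equals
    \<open>(u - \<epsilon> ^ s * a') ^ n - b' ^ n\<close>.\<close>
  also have "\<dots> = (\<Prod>s\<in>{1..n}. \<Prod>r\<in>{1..n}. (u - \<epsilon> ^ s * a') - \<epsilon> ^ r * b')"
    by (simp only: diff_power_factorization[OF assms(1,2), symmetric] pow)
  also have "\<dots> = (\<Prod>r\<in>{1..n}. \<Prod>s\<in>{1..n}. u - \<epsilon> ^ r * a - \<epsilon> ^ s * b)"
    by (rule double_product_cong[OF assms(1,2) a'[symmetric] b'[symmetric]])
  finally show ?thesis .
qed

section \<open>Symmetry and scaling\<close>

lemma symmetric3I:
  assumes "\<And>a b c. f a b c = f a c b" and "\<And>a b c. f a b c = f b a c"
  shows "symmetric3 f"
  unfolding symmetric3_def using assms by metis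

text \<open>Two transpositions generate all permutations of the arguments. Exchanging
  \<open>x\<close> and \<open>y\<close> exchanges \<open>a\<close> and \<open>b\<close>. Exchanging
  \<open>z\<close> and \<open>x\<close> replaces \<open>(u, a)\<close> by \<open>(- a, - u)\<close>,
  since these are roots of \<open>x\<close> and \<open>(-1) ^ n * z\<close>.\<close>

lemma symmetric3_nv_poly:
  assumes "n > 0" and "primitive_root_of_unity n \<epsilon>" and "root_branch n \<rho>"
  shows "symmetric3 (nv_poly n \<epsilon> \<rho>)"
proof (rule symmetric3I)
  fix z x y
  define u a b where "u = \<rho> z" and "a = \<rho> ((-1) ^ n * x)" and "b = \<rho> ((-1) ^ n * y)"
  have u: "u ^ n = z" and a: "a ^ n = (-1) ^ n * x" and b: "b ^ n = (-1) ^ n * y"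
    using assms(3) by (simp_all add: u_def a_def b_def root_branch_def)
  have a': "(- a) ^ n = x" and u': "(- u) ^ n = (-1) ^ n * z"
    using a u by (simp_all add: power_minus[of a] power_minus[of u] flip: mult.assoc power_mult_distrib)
  note eq = nv_poly_double_product[OF assms]
  show "nv_poly n \<epsilon> \<rho> z x y = nv_poly n \<epsilon> \<rho> z y x"
    by (simp only: eq[OF u a b] eq[OF u b a], subst prod.swap) (simp add: algebra_simps)
  have "nv_poly n \<epsilon> \<rho> x z y = (\<Prod>r\<in>{1..n}. \<Prod>s\<in>{1..n}. - a - \<epsilon> ^ r * - u - \<epsilon> ^ s * b)"
    by (rule eq[OF a' u' b])
  also have "\<dots> = (\<Prod>s\<in>{1..n}. \<Prod>r\<in>{1..n}. (- a - \<epsilon> ^ s * b) - \<epsilon> ^ r * - u)"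
    by (subst prod.swap) (simp add: algebra_simps)
  also have "\<dots> = (\<Prod>s\<in>{1..n}. (- (a + \<epsilon> ^ s * b)) ^ n - (-1) ^ n * u ^ n)"
    by (simp only: diff_power_factorization[OF assms(1,2), symmetric] power_minus[of u])
      (simp add: algebra_simps)
  also have "\<dots> = (\<Prod>s\<in>{1..n}. (-1) ^ Suc n * (z - (a + \<epsilon> ^ s * b) ^ n))"
    by (subst power_minus) (simp add: algebra_simps u)
  also have "\<dots> = ((-1) ^ Suc n) ^ n * nv_poly n \<epsilon> \<rho> z x y"
    by (simp only: prod.distrib nv_poly_altdef a_def b_def) simp
  \<comment> \<open>Each of the \<open>n\<close> factors contributed one sign
    \<open>(-1) ^ Suc n\<close>, and \<open>n * Suc n\<close> is even.\<close>
  also have "((-1) ^ Suc n) ^ n = (1 :: complex)"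
    by (subst power_mult[symmetric]) simp
  finally show "nv_poly n \<epsilon> \<rho> z x y = nv_poly n \<epsilon> \<rho> x z y" by simp
qed

text \<open>If \<open>c ^ n = t\<close>, all three roots may be scaled by \<open>c\<close>. Each of
  the \<open>n * n\<close> linear factors then gains a factor \<open>c\<close>, and
  \<open>c ^ (n * n) = t ^ n\<close>.\<close>

lemma nv_poly_scale:
  assumes "n > 0" and "primitive_root_of_unity n \<epsilon>" and "root_branch n \<rho>"
  shows "nv_poly n \<epsilon> \<rho> (t * z) (t * x) (t * y) = t ^ n * nv_poly n \<epsilon> \<rho> z x y"
proof -
  define u a b c where "u = \<rho> z" and "a = \<rho> ((-1) ^ n * x)" and "b = \<rho> ((-1) ^ n * y)"
    and "c = \<rho> t"
  have u: "u ^ n = z" and a: "a ^ n = (-1) ^ n * x" and b: "b ^ n = (-1) ^ n * y" and c: "c ^ n = t"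
    using assms(3) by (simp_all add: u_def a_def b_def c_def root_branch_def)
  have "nv_poly n \<epsilon> \<rho> (t * z) (t * x) (t * y) =
      (\<Prod>r\<in>{1..n}. \<Prod>s\<in>{1..n}. c * u - \<epsilon> ^ r * (c * a) - \<epsilon> ^ s * (c * b))"
    using u a b c by (intro nv_poly_double_product[OF assms]) (simp_all add: power_mult_distrib)
  also have "\<dots> = (\<Prod>r\<in>{1..n}. \<Prod>s\<in>{1..n}. c * (u - \<epsilon> ^ r * a - \<epsilon> ^ s * b))"
    by (simp add: algebra_simps)
  also have "\<dots> = t ^ n * nv_poly n \<epsilon> \<rho> z x y"
    by (simp add: prod.distrib c nv_poly_double_product[OF assms u a b])
  finally show ?thesis .
qed

section \<open>Kronecker sums and companion matrices\<close>

text \<open>An index \<open>k\<close> of a Kronecker product encodes the pair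
  \<open>(k div q, k mod q)\<close>, so that sums and products over \<open>k\<close> become double
  ones over the indices of the two factors.\<close>

lemma bij_betw_div_mod:
  "bij_betw (\<lambda>k. (k div q, k mod q)) {..<p * q} ({..<p} \<times> {..<q :: nat})"
proof (rule bij_betw_byWitness[where f' = "\<lambda>(i, j). i * q + j"])
  show "(\<lambda>k. (k div q, k mod q)) ` {..<p * q} \<subseteq> {..<p} \<times> {..<q}"
    by (cases "q = 0") (auto simp: less_mult_imp_div_less)
  show "(\<lambda>(i, j). i * q + j) ` ({..<p} \<times> {..<q}) \<subseteq> {..<p * q}"
  proof clarsimp
    fix i j assume "i < p" "j < q"
    then have "i * q + j < Suc i * q" and "Suc i * q \<le> p * q" by (simp, intro mult_le_mono1) auto
    then show "i * q + j < p * q" by linarith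
  qed
qed auto

lemma sum_lessThan_mult:
  fixes f :: "nat \<Rightarrow> nat \<Rightarrow> 'a :: comm_monoid_add"
  shows "(\<Sum>k<p * q. f (k div q) (k mod q)) = (\<Sum>i<p. \<Sum>j<q. f i j)"
  using sum.reindex_bij_betw[OF bij_betw_div_mod, of "\<lambda>(i, j). f i j" q p]
  by (simp add: sum.cartesian_product)

lemma prod_lessThan_mult:
  fixes f :: "nat \<Rightarrow> nat \<Rightarrow> 'a :: comm_monoid_mult"
  shows "(\<Prod>k<p * q. f (k div q) (k mod q)) = (\<Prod>i<p. \<Prod>j<q. f i j)"
  using prod.reindex_bij_betw[OF bij_betw_div_mod, of "\<lambda>(i, j). f i j" q p]
  by (simp add: prod.cartesian_product)

lemma div_mod_less:
  assumes "k < p * (q :: nat)"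
  shows "k div q < p" and "k mod q < q"
  using assms by (auto simp: less_mult_imp_div_less) (cases "q = 0"; simp)

lemma kronecker_prod_carrier [simp]:
  "A \<in> carrier_mat m n \<Longrightarrow> B \<in> carrier_mat p q \<Longrightarrow>
    kronecker_prod A B \<in> carrier_mat (m * p) (n * q)"
  by (auto simp: kronecker_prod_def)

lemma kronecker_prod_index:
  assumes "A \<in> carrier_mat m n" and "B \<in> carrier_mat p q" and "i < m * p" and "j < n * q"
  shows "kronecker_prod A B $$ (i, j) = A $$ (i div p, j div q) * B $$ (i mod p, j mod q)"
  using assms by (auto simp: kronecker_prod_def)

text \<open>Splitting the summation index into its two components turns the sum into a product of
  two independent sums, one for each matrix product.\<close>

lemma kronecker_prod_mult:
  fixes A B C D :: "'a :: comm_semiring_1 mat"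
  assumes A: "A \<in> carrier_mat m n" and B: "B \<in> carrier_mat p q"
    and C: "C \<in> carrier_mat n l" and D: "D \<in> carrier_mat q r"
  shows "kronecker_prod A B * kronecker_prod C D = kronecker_prod (A * C) (B * D)"
proof (rule eq_matI)
  have AB: "kronecker_prod A B \<in> carrier_mat (m * p) (n * q)" using A B by simp
  have CD: "kronecker_prod C D \<in> carrier_mat (n * q) (l * r)" using C D by simp
  have AC: "A * C \<in> carrier_mat m l" and BD: "B * D \<in> carrier_mat p r"
    using A B C D by auto
  show "dim_row (kronecker_prod A B * kronecker_prod C D) = dim_row (kronecker_prod (A * C) (B * D))"
    and "dim_col (kronecker_prod A B * kronecker_prod C D) = dim_col (kronecker_prod (A * C) (B * D))"
    using A B C D by (auto simp: kronecker_prod_def)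
  fix i j assume "i < dim_row (kronecker_prod (A * C) (B * D))"
    and "j < dim_col (kronecker_prod (A * C) (B * D))"
  then have i: "i < m * p" and j: "j < l * r" using A B C D by (auto simp: kronecker_prod_def)
  note i' = div_mod_less[OF i] and j' = div_mod_less[OF j]
  have "(kronecker_prod A B * kronecker_prod C D) $$ (i, j) =
      (\<Sum>k<n * q. kronecker_prod A B $$ (i, k) * kronecker_prod C D $$ (k, j))"
    using AB CD i j by (auto simp: scalar_prod_def atLeast0LessThan intro!: sum.cong)
  also have "\<dots> = (\<Sum>k<n * q. (A $$ (i div p, k div q) * C $$ (k div q, j div r)) *
      (B $$ (i mod p, k mod q) * D $$ (k mod q, j mod r)))"
    by (rule sum.cong) (use i j in \<open>auto simp: kronecker_prod_index[OF A B] kronecker_prod_index[OF C D] ac_simps\<close>)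
  also have "\<dots> = (\<Sum>k<n. \<Sum>k'<q. (A $$ (i div p, k) * C $$ (k, j div r)) *
      (B $$ (i mod p, k') * D $$ (k', j mod r)))"
    by (rule sum_lessThan_mult)
  also have "\<dots> = (\<Sum>k<n. A $$ (i div p, k) * C $$ (k, j div r)) *
      (\<Sum>k'<q. B $$ (i mod p, k') * D $$ (k', j mod r))"
    by (rule sum_product[symmetric])
  also have "\<dots> = (A * C) $$ (i div p, j div r) * (B * D) $$ (i mod p, j mod r)"
    using A B C D i' j' by (auto simp: scalar_prod_def atLeast0LessThan intro!: arg_cong2[where f = "(*)"] sum.cong)
  also have "\<dots> = kronecker_prod (A * C) (B * D) $$ (i, j)"
    by (rule kronecker_prod_index[OF AC BD i j, symmetric])
  finally show "(kronecker_prod A B * kronecker_prod C D) $$ (i, j) =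
      kronecker_prod (A * C) (B * D) $$ (i, j)" .
qed

lemma kronecker_prod_one: "kronecker_prod (1\<^sub>m p) (1\<^sub>m q) = 1\<^sub>m (p * q)"
proof (rule eq_matI)
  fix i j assume "i < dim_row (1\<^sub>m (p * q) :: 'a mat)" "j < dim_col (1\<^sub>m (p * q) :: 'a mat)"
  then have i: "i < p * q" and j: "j < p * q" by auto
  have "i = j \<longleftrightarrow> i div q = j div q \<and> i mod q = j mod q"
    by (metis div_mult_mod_eq)
  then show "kronecker_prod (1\<^sub>m p) (1\<^sub>m q) $$ (i, j) = (1\<^sub>m (p * q) :: 'a mat) $$ (i, j)"
    using i j div_mod_less[OF i] div_mod_less[OF j]
    by (subst kronecker_prod_index[of _ p p _ q q]) auto
qed (auto simp: kronecker_prod_def)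

section \<open>Similarity and eigenvalues of Kronecker sums\<close>

lemma kronecker_sum_carrier [simp]:
  "A \<in> carrier_mat p p \<Longrightarrow> B \<in> carrier_mat q q \<Longrightarrow>
    kronecker_sum A B \<in> carrier_mat (p * q) (p * q)"
  by (auto simp: kronecker_sum_def kronecker_prod_def)

lemma kronecker_sum_index:
  assumes "A \<in> carrier_mat p p" and "B \<in> carrier_mat q q" and "i < p * q" and "j < p * q"
  shows "kronecker_sum A B $$ (i, j) =
    (if i mod q = j mod q then A $$ (i div q, j div q) else 0) +
    (if i div q = j div q then B $$ (i mod q, j mod q) else 0)"
proof -
  note carrier_matD[OF kronecker_prod_carrier[OF one_carrier_mat assms(2)], of p, simp]
  show ?thesis
    using assms div_mod_less[OF assms(3)] div_mod_less[OF assms(4)]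
    by (auto simp: kronecker_sum_def kronecker_prod_index[of _ p p _ q q])
qed

text \<open>By the mixed-product rule \<open>kronecker_prod_mult\<close>, the Kronecker products of
  the witnesses conjugate both summands at once: on each summand one factor undergoes its own
  similarity, while the identity in the other factor is preserved because \<open>P * Q\<close> and
  \<open>P' * Q'\<close> are identities.\<close>

lemma similar_mat_kronecker_sum:
  fixes A A' B B' :: "'a :: comm_semiring_1 mat"
  assumes "similar_mat_wit A A' P Q" and "similar_mat_wit B B' P' Q'"
  shows "similar_mat_wit (kronecker_sum A B) (kronecker_sum A' B') (kronecker_prod P P') (kronecker_prod Q Q')"
proof -
  define p q where "p = dim_row A" and "q = dim_row B"
  note A = similar_mat_witD(4-7)[OF p_def assms(1)] and PQ = similar_mat_witD(1-3)[OF p_def assms(1)]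
  note B = similar_mat_witD(4-7)[OF q_def assms(2)] and PQ' = similar_mat_witD(1-3)[OF q_def assms(2)]
  let ?P = "kronecker_prod P P'" and ?Q = "kronecker_prod Q Q'"
  have [simp]: "?P \<in> carrier_mat (p * q) (p * q)" "?Q \<in> carrier_mat (p * q) (p * q)"
    "kronecker_prod A' (1\<^sub>m q) \<in> carrier_mat (p * q) (p * q)"
    "kronecker_prod (1\<^sub>m p) B' \<in> carrier_mat (p * q) (p * q)"
    using A B by auto
  have [simp]: "?P * kronecker_prod A' (1\<^sub>m q) \<in> carrier_mat (p * q) (p * q)"
    "?P * kronecker_prod (1\<^sub>m p) B' \<in> carrier_mat (p * q) (p * q)"
    by (rule mult_carrier_mat[of _ _ "p * q"]; simp)+
  have "?P * kronecker_sum A' B' * ?Q =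
      ?P * kronecker_prod A' (1\<^sub>m q) * ?Q + ?P * kronecker_prod (1\<^sub>m p) B' * ?Q"
    using A B unfolding kronecker_sum_def
    by (simp add: mult_add_distrib_mat[where nr = "p * q" and n = "p * q" and nc = "p * q"]
        add_mult_distrib_mat[where nr = "p * q" and nc = "p * q" and n = "p * q"])
  also have "?P * kronecker_prod A' (1\<^sub>m q) * ?Q = kronecker_prod A (1\<^sub>m q)"
    using A B PQ'(1) PQ(3)[symmetric] by (simp add: kronecker_prod_mult[of _ p p _ q q _ p _ q])
  also have "?P * kronecker_prod (1\<^sub>m p) B' * ?Q = kronecker_prod (1\<^sub>m p) B"
    using A B PQ(1) PQ'(3)[symmetric] by (simp add: kronecker_prod_mult[of _ p p _ q q _ p _ q])
  finally have "?P * kronecker_sum A' B' * ?Q = kronecker_sum A B"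
    using A B by (simp add: kronecker_sum_def)
  moreover have "?P * ?Q = 1\<^sub>m (p * q)" "?Q * ?P = 1\<^sub>m (p * q)"
    using A B PQ(1,2) PQ'(1,2) by (simp_all add: kronecker_prod_mult[of _ p p _ q q _ p _ q] kronecker_prod_one)
  moreover have "kronecker_sum A B \<in> carrier_mat (p * q) (p * q)"
    "kronecker_sum A' B' \<in> carrier_mat (p * q) (p * q)"
    using A B by simp_all
  ultimately show ?thesis
    by (simp add: similar_mat_wit_def Let_def)
qed

text \<open>The order of indices is lexicographic in \<open>(k div q, k mod q)\<close>. Below the
  diagonal the column is smaller in the first component, or equal there and smaller in the second;
  any contributing entry of \<open>A\<close> or \<open>B\<close> is then itself below the
  diagonal.\<close>

lemma upper_triangular_kronecker_sum:
  assumes A: "A \<in> carrier_mat p p" and B: "B \<in> carrier_mat q q"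
    and "upper_triangular A" and "upper_triangular B"
  shows "upper_triangular (kronecker_sum A B)"
proof
  fix i j assume ji: "j < i" and "i < dim_row (kronecker_sum A B)"
  then have i: "i < p * q" and j: "j < p * q"
    using carrier_matD(1)[OF kronecker_sum_carrier[OF A B]] by auto
  have "j div q \<le> i div q" using ji by (simp add: div_le_mono)
  moreover have "j mod q < i mod q" if "i div q = j div q"
    using ji that by (metis div_mult_mod_eq nat_add_left_cancel_less)
  ultimately have "i div q = j div q \<and> j mod q < i mod q \<or> j div q < i div q"
    by linarith
  then show "kronecker_sum A B $$ (i, j) = 0"
    using assms div_mod_less[OF i] by (auto simp: kronecker_sum_index[OF A B i j])
qed

text \<open>Schur decomposition yields triangular forms with \<open>as\<close> and \<open>bs\<close>
  on their diagonals. The Kronecker sum of these forms is again triangular, and its diagonal lists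
  all sums of the two diagonals.\<close>

lemma char_poly_kronecker_sum:
  fixes A B :: "'a :: conjugatable_ordered_field mat"
  assumes A: "A \<in> carrier_mat p p" and B: "B \<in> carrier_mat q q"
    and as: "char_poly A = (\<Prod>a\<leftarrow>as. [:- a, 1:])" and bs: "char_poly B = (\<Prod>b\<leftarrow>bs. [:- b, 1:])"
  shows "char_poly (kronecker_sum A B) = (\<Prod>a\<leftarrow>as. \<Prod>b\<leftarrow>bs. [:- (a + b), 1:])"
proof -
  obtain S P Q where S: "similar_mat_wit A S P Q" "upper_triangular S" "diag_mat S = as"
    using schur_decomposition[OF A as] by (metis surj_pair)
  obtain T P' Q' where T: "similar_mat_wit B T P' Q'" "upper_triangular T" "diag_mat T = bs"
    using schur_decomposition[OF B bs] by (metis surj_pair)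
  have Sc: "S \<in> carrier_mat p p" and Tc: "T \<in> carrier_mat q q"
    using S(1) T(1) A B by (auto simp: similar_mat_wit_def Let_def)
  note ST = kronecker_sum_carrier[OF Sc Tc]
  have "similar_mat (kronecker_sum A B) (kronecker_sum S T)"
    using similar_mat_kronecker_sum[OF S(1) T(1)] by (auto simp: similar_mat_def)
  then have "char_poly (kronecker_sum A B) = char_poly (kronecker_sum S T)"
    by (rule char_poly_similar)
  also have "\<dots> = (\<Prod>a\<leftarrow>diag_mat (kronecker_sum S T). [:- a, 1:])"
    by (rule char_poly_upper_triangular[OF ST upper_triangular_kronecker_sum[OF Sc Tc S(2) T(2)]])
  also have "\<dots> = (\<Prod>k<p * q. [:- (kronecker_sum S T $$ (k, k)), 1:])"
    using ST by (simp add: diag_mat_def prod.list_conv_set_nth atLeast0LessThan)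
  also have "\<dots> = (\<Prod>k<p * q. [:- (S $$ (k div q, k div q) + T $$ (k mod q, k mod q)), 1:])"
    by (simp add: kronecker_sum_index[OF Sc Tc])
  also have "\<dots> = (\<Prod>i<p. \<Prod>j<q. [:- (S $$ (i, i) + T $$ (j, j)), 1:])"
    by (rule prod_lessThan_mult)
  also have "\<dots> = (\<Prod>a\<leftarrow>as. \<Prod>b\<leftarrow>bs. [:- (a + b), 1:])"
    using Sc Tc by (simp add: diag_mat_def prod.list_conv_set_nth atLeast0LessThan flip: S(3) T(3))
  finally show ?thesis .
qed

section \<open>The characteristic polynomial of the companion matrix\<close>

lemma frobenius_mat_carrier [simp]: "frobenius_mat n a \<in> carrier_mat n n"
  by (simp add: frobenius_mat_def)

text \<open>Laplace expansion along the first row leaves only the two corner terms, whose minors are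
  triangular. For \<open>n = 1\<close> the two corners coincide, so this case is treated
  apart.\<close>

lemma char_poly_frobenius_mat:
  assumes "n > 0"
  shows "char_poly (frobenius_mat n a) = monom 1 n + [:a:]"
proof -
  define M where "M = char_poly_matrix (frobenius_mat n a)"
  have M: "M \<in> carrier_mat n n" by (simp add: M_def)
  have M_index: "M $$ (i, j) = (if i = j then [:0, 1:] else 0) +
      (if i = 0 \<and> j = n - 1 then [:a:] else if i = j + 1 then -1 else 0)" if "i < n" "j < n" for i j
    using that by (auto simp: M_def char_poly_matrix_def frobenius_mat_def one_pCons)
  have X: "[:0, 1:] ^ k = (monom 1 k :: 'a poly)" for k
    by (simp add: monom_altdef)
  show ?thesis
  proof (cases "n = 1")
    case True
    then have "det M = M $$ (0, 0)"
      by (intro det_single) (use M in simp)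
    then show ?thesis
      using M_index[of 0 0] True by (simp add: char_poly_def M_def monom_Suc monom_0)
  next
    case False
    define m where "m = n - 1"
    have n: "n = Suc m" and "m > 0" using False assms by (auto simp: m_def)
    have del: "mat_delete M 0 j \<in> carrier_mat m m" for j
      using M by (auto simp: mat_delete_def n)
    have "det M = (\<Sum>j<n. M $$ (0, j) * cofactor M 0 j)"
      using assms by (intro laplace_expansion_row[OF M]) auto
    also have "\<dots> = (\<Sum>j\<in>{0, m}. M $$ (0, j) * cofactor M 0 j)"
      by (rule sum.mono_neutral_right) (use M_index n in auto)
    also have "\<dots> = [:0, 1:] * cofactor M 0 0 + [:a:] * cofactor M 0 m"
      using M_index[of 0 0] M_index[of 0 m] n \<open>m > 0\<close> by simp
    also have "cofactor M 0 0 = [:0, 1:] ^ m"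
    proof -
      have "det (mat_delete M 0 0) = prod_list (diag_mat (mat_delete M 0 0))"
        by (rule det_lower_triangular[OF _ del])
          (use M in \<open>auto simp: mat_delete_def n M_index\<close>)
      also have "diag_mat (mat_delete M 0 0) = replicate m [:0, 1:]"
        using M by (intro nth_equalityI) (auto simp: diag_mat_def mat_delete_def n M_index)
      finally show ?thesis by (simp add: cofactor_def)
    qed
    \<comment> \<open>Without the first row and last column, the diagonal consists of the former
      subdiagonal entries \<open>-1\<close>. The determinant \<open>(-1) ^ m\<close> cancels the
      sign of the cofactor.\<close>
    also have "cofactor M 0 m = 1"
    proof -
      have "upper_triangular (mat_delete M 0 m)"
        using M by (auto simp: mat_delete_def n M_index)
      then have "det (mat_delete M 0 m) = prod_list (diag_mat (mat_delete M 0 m))"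
        by (rule det_upper_triangular[OF _ del])
      also have "diag_mat (mat_delete M 0 m) = replicate m (-1)"
        using M by (intro nth_equalityI) (auto simp: diag_mat_def mat_delete_def n M_index)
      finally show ?thesis by (simp add: cofactor_def flip: power_mult_distrib)
    qed
    also have "[:0, 1:] * [:0, 1:] ^ m + [:a:] * 1 = monom 1 n + [:a:]"
      by (simp add: n monom_Suc X)
    finally show ?thesis by (simp add: char_poly_def M_def)
  qed
qed

section \<open>Polynomial functions in three variables\<close>

lemma poly_altdef_le:
  fixes p :: "'a :: comm_semiring_1 poly"
  shows "degree p \<le> N \<Longrightarrow> poly p x = (\<Sum>i\<le>N. coeff p i * x ^ i)"
  unfolding poly_altdef by (rule sum.mono_neutral_left) (auto simp: coeff_eq_0)

text \<open>All coefficients beyond the degree are \<open>0\<close>, so only finitely many values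
  occur. With \<open>g = degree\<close> this bounds the inner degrees of a nested polynomial
  uniformly.\<close>

lemma bounded_coeffs:
  fixes g :: "'a :: zero \<Rightarrow> nat"
  shows "\<exists>N. \<forall>i. g (coeff p i) \<le> N"
proof -
  have "range (coeff p) \<subseteq> insert 0 (coeff p ` {..degree p})"
  proof clarsimp
    fix i assume "coeff p i \<notin> coeff p ` {..degree p}"
    then show "coeff p i = 0" by (metis atMost_iff coeff_eq_0 imageI not_le)
  qed
  then have "finite (g ` range (coeff p))"
    by (meson finite_atMost finite_imageI finite_insert finite_subset)
  then show ?thesis
    by (auto simp: finite_nat_set_iff_bounded_le)
qed

text \<open>Integral polynomials in two variables are nested, with the outer variable standing for
  \<open>x\<close> and the inner one for \<open>y\<close>. In this form they are a commutative ring
  over which characteristic polynomials can be formed.\<close>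

definition eval_int_poly2 :: "complex \<Rightarrow> complex \<Rightarrow> int poly poly \<Rightarrow> complex" where
  "eval_int_poly2 x y q = poly (map_poly (\<lambda>r. poly (of_int_poly r) y) q) x"

lemma comm_ring_hom_eval_int_poly2: "comm_ring_hom (eval_int_poly2 x y)"
proof -
  interpret inner: comm_ring_hom "\<lambda>r :: int poly. poly (of_int_poly r) y"
    by unfold_locales (auto simp: hom_distribs)
  interpret outer: map_poly_comm_ring_hom "\<lambda>r :: int poly. poly (of_int_poly r) y" ..
  show ?thesis
    by unfold_locales
      (simp_all add: eval_int_poly2_def outer.hom_add outer.hom_mult)
qed

lemma eval_int_poly2_expansion:
  assumes "degree q \<le> N" and "\<And>i. degree (coeff q i) \<le> N"
  shows "eval_int_poly2 x y q = (\<Sum>i\<le>N. \<Sum>j\<le>N. of_int (coeff (coeff q i) j) * x ^ i * y ^ j)"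
proof -
  have inner: "poly (of_int_poly (coeff q i)) y = (\<Sum>j\<le>N. of_int (coeff (coeff q i) j) * y ^ j)" for i
    using assms(2) by (subst poly_altdef_le[of _ N]) auto
  have "degree (map_poly (\<lambda>r. poly (of_int_poly r) y) q) \<le> N"
    using degree_map_poly_le assms(1) by (rule order_trans)
  then have "eval_int_poly2 x y q = (\<Sum>i\<le>N. poly (of_int_poly (coeff q i)) y * x ^ i)"
    unfolding eval_int_poly2_def by (subst poly_altdef_le[of _ N]) (auto simp: coeff_map_poly)
  then show ?thesis
    by (simp add: inner sum_distrib_left sum_distrib_right mult_ac)
qed

text \<open>The second property makes coefficients vanish outside the summation box, so that
  comparing coefficients inside the box settles all indices.\<close>

lemma int_poly3_expansion:
  fixes Q :: "int poly poly poly"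
  obtains c :: "nat \<Rightarrow> nat \<Rightarrow> nat \<Rightarrow> int" and N :: nat where
    "\<And>x y z. poly (map_poly (eval_int_poly2 x y) Q) z =
      (\<Sum>k\<le>N. \<Sum>i\<le>N. \<Sum>j\<le>N. of_int (c k i j) * z ^ k * x ^ i * y ^ j)"
    and "\<And>k i j. c k i j \<noteq> 0 \<Longrightarrow> k \<le> N \<and> i \<le> N \<and> j \<le> N"
proof -
  have "\<forall>q :: int poly poly. \<exists>N. \<forall>i. degree (coeff q i) \<le> N"
    using bounded_coeffs[where g = degree] by blast
  \<comment> \<open>\<open>g q\<close> bounds the inner degrees within a single \<open>q\<close>;
    bounding \<open>g\<close> over the coefficients of \<open>Q\<close> then gives a uniform
    bound.\<close>
  then obtain g where g: "\<And>(q :: int poly poly) i. degree (coeff q i) \<le> g q" by metis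
  obtain N1 where N1: "\<And>k. degree (coeff Q k) \<le> N1" using bounded_coeffs[where g = degree] by blast
  obtain N2 where N2: "\<And>k. g (coeff Q k) \<le> N2" using bounded_coeffs[where g = g] by blast
  define N where "N = max (degree Q) (max N1 N2)"
  have d: "degree Q \<le> N" "\<And>k. degree (coeff Q k) \<le> N" "\<And>k i. degree (coeff (coeff Q k) i) \<le> N"
    using N1 order_trans[OF g N2] by (simp_all add: N_def le_max_iff_disj)
  show ?thesis
  proof (rule that[where c = "\<lambda>k i j. coeff (coeff (coeff Q k) i) j" and N = N])
    fix x y z
    interpret comm_ring_hom "eval_int_poly2 x y" by (rule comm_ring_hom_eval_int_poly2)
    have "degree (map_poly (eval_int_poly2 x y) Q) \<le> N"
      using degree_map_poly_le d(1) by (rule order_trans)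
    then have "poly (map_poly (eval_int_poly2 x y) Q) z = (\<Sum>k\<le>N. eval_int_poly2 x y (coeff Q k) * z ^ k)"
      by (subst poly_altdef_le[of _ N]) (auto simp: coeff_map_poly)
    then show "poly (map_poly (eval_int_poly2 x y) Q) z =
        (\<Sum>k\<le>N. \<Sum>i\<le>N. \<Sum>j\<le>N. of_int (coeff (coeff (coeff Q k) i) j) * z ^ k * x ^ i * y ^ j)"
      by (simp add: eval_int_poly2_expansion[OF d(2,3)] sum_distrib_left sum_distrib_right mult_ac)
  next
    fix k i j assume nz: "coeff (coeff (coeff Q k) i) j \<noteq> 0"
    then have "coeff (coeff Q k) i \<noteq> 0" and "coeff Q k \<noteq> 0" by auto
    then show "k \<le> N \<and> i \<le> N \<and> j \<le> N"
      using nz d order_trans[OF le_degree] by meson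
  qed
qed

text \<open>With the other variables fixed, the sum is a univariate polynomial vanishing everywhere,
  hence has zero coefficients. This is applied to \<open>x\<close>, \<open>y\<close> and
  \<open>z\<close> in turn.\<close>

lemma polyfun3_eq_0:
  fixes d :: "nat \<Rightarrow> nat \<Rightarrow> nat \<Rightarrow> complex"
  assumes "\<And>x y z. (\<Sum>i\<le>N. \<Sum>j\<le>N. \<Sum>k\<le>N. d i j k * x ^ i * y ^ j * z ^ k) = 0"
    and "i \<le> N" and "j \<le> N" and "k \<le> N"
  shows "d i j k = 0"
proof -
  have "\<forall>i\<le>N. (\<Sum>j\<le>N. \<Sum>k\<le>N. d i j k * y ^ j * z ^ k) = 0" for y z
  proof (rule polyfun_eq_0[THEN iffD1], rule allI)
    fix x
    have "(\<Sum>i\<le>N. (\<Sum>j\<le>N. \<Sum>k\<le>N. d i j k * y ^ j * z ^ k) * x ^ i) =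
        (\<Sum>i\<le>N. \<Sum>j\<le>N. \<Sum>k\<le>N. d i j k * x ^ i * y ^ j * z ^ k)"
      by (simp add: sum_distrib_left sum_distrib_right mult_ac)
    then show "(\<Sum>i\<le>N. (\<Sum>j\<le>N. \<Sum>k\<le>N. d i j k * y ^ j * z ^ k) * x ^ i) = 0"
      by (simp only: assms(1))
  qed
  then have i: "(\<Sum>j\<le>N. \<Sum>k\<le>N. d i j k * y ^ j * z ^ k) = 0" for y z
    using assms(2) by blast
  have "\<forall>j\<le>N. (\<Sum>k\<le>N. d i j k * z ^ k) = 0" for z
  proof (rule polyfun_eq_0[THEN iffD1], rule allI)
    fix y
    have "(\<Sum>j\<le>N. (\<Sum>k\<le>N. d i j k * z ^ k) * y ^ j) = (\<Sum>j\<le>N. \<Sum>k\<le>N. d i j k * y ^ j * z ^ k)"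
      by (simp add: sum_distrib_left sum_distrib_right mult_ac)
    then show "(\<Sum>j\<le>N. (\<Sum>k\<le>N. d i j k * z ^ k) * y ^ j) = 0"
      by (simp only: i)
  qed
  then have "\<forall>k\<le>N. d i j k = 0"
    using assms(3) by (intro polyfun_eq_0[THEN iffD1]) blast
  then show ?thesis
    using assms(4) by blast
qed

text \<open>Comparing coefficients in \<open>scale\<close> gives
  \<open>c i j k * (2 ^ (i + j + k) - 2 ^ d) = 0\<close>, and distinct exponents give distinct
  powers of 2. The nonzero value of \<open>f\<close> forces a nonzero coefficient.\<close>

lemma homogeneous_int_poly3I:
  fixes c :: "nat \<Rightarrow> nat \<Rightarrow> nat \<Rightarrow> int"
  assumes f: "\<And>x y z. f x y z = (\<Sum>i\<le>N. \<Sum>j\<le>N. \<Sum>k\<le>N. of_int (c i j k) * x ^ i * y ^ j * z ^ k)"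
    and supp: "\<And>i j k. c i j k \<noteq> 0 \<Longrightarrow> i \<le> N \<and> j \<le> N \<and> k \<le> N"
    and scale: "\<And>x y z. f (2 * x) (2 * y) (2 * z) = 2 ^ d * f x y z"
    and nz: "f x0 y0 z0 \<noteq> 0"
  shows "homogeneous_int_poly3 d f"
proof -
  have deg: "i + j + k = d" if "c i j k \<noteq> 0" for i j k
  proof -
    have "(\<Sum>i\<le>N. \<Sum>j\<le>N. \<Sum>k\<le>N. of_int (c i j k) * (2 ^ (i + j + k) - 2 ^ d) * x ^ i * y ^ j * z ^ k) = 0"
      for x y z :: complex
      using scale[of x y z]
      by (simp add: f sum_distrib_left power_mult_distrib power_add algebra_simps sum_subtractf)
    from polyfun3_eq_0[OF this] have "of_int (c i j k) * (2 ^ (i + j + k) - 2 ^ d) = (0 :: complex)"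
      using supp[OF that] by simp
    then have "(2 :: complex) ^ (i + j + k) = 2 ^ d" using that by simp
    then have "(2 :: nat) ^ (i + j + k) = 2 ^ d"
      by (metis of_nat_eq_iff of_nat_numeral of_nat_power)
    then show ?thesis by simp
  qed
  have fin: "finite {(i, j, k). i + j + k = d}"
    by (rule finite_subset[of _ "{..d} \<times> {..d} \<times> {..d}"]) auto
  have eq: "f x y z = (\<Sum>(i, j, k)\<in>{(i, j, k). i + j + k = d}. of_int (c i j k) * x ^ i * y ^ j * z ^ k)"
    for x y z
  proof -
    have "f x y z = (\<Sum>(i, j, k)\<in>{..N} \<times> {..N} \<times> {..N}. of_int (c i j k) * x ^ i * y ^ j * z ^ k)"
      by (simp only: f sum.cartesian_product[symmetric])
    also have "\<dots> = (\<Sum>(i, j, k)\<in>{(i, j, k). i + j + k = d}. of_int (c i j k) * x ^ i * y ^ j * z ^ k)"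
    proof (rule sum.mono_neutral_cong)
      show "(case t of (i, j, k) \<Rightarrow> of_int (c i j k) * x ^ i * y ^ j * z ^ k) = 0"
        if "t \<in> {..N} \<times> {..N} \<times> {..N} - {(i, j, k). i + j + k = d}" for t
      proof -
        obtain i j k where t: "t = (i, j, k)" by (rule prod_cases3)
        then have "c i j k = 0" using deg that by blast
        then show ?thesis by (simp add: t)
      qed
      show "(case t of (i, j, k) \<Rightarrow> of_int (c i j k) * x ^ i * y ^ j * z ^ k) = 0"
        if "t \<in> {(i, j, k). i + j + k = d} - {..N} \<times> {..N} \<times> {..N}" for t
      proof -
        obtain i j k where t: "t = (i, j, k)" by (rule prod_cases3)
        then have "c i j k = 0" using supp that by blast
        then show ?thesis by (simp add: t)
      qed
    qed (use fin in simp_all)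
    finally show ?thesis .
  qed
  moreover have "\<exists>i j k. i + j + k = d \<and> c i j k \<noteq> 0"
  proof (rule ccontr)
    assume "\<nexists>i j k. i + j + k = d \<and> c i j k \<noteq> 0"
    then have "f x0 y0 z0 = 0" unfolding eq by (intro sum.neutral) auto
    with nz show False by simp
  qed
  ultimately show ?thesis unfolding homogeneous_int_poly3_def by blast
qed

section \<open>Polynomials in an n-th power\<close>

lemma primitive_root_of_unity_power_eq_1_iff:
  assumes "n > 0" and "primitive_root_of_unity n \<epsilon>"
  shows "\<epsilon> ^ k = 1 \<longleftrightarrow> n dvd k"
proof -
  have "\<epsilon> ^ k = \<epsilon> ^ (n * (k div n) + k mod n)" by simp
  also have "\<dots> = \<epsilon> ^ (k mod n)"
    using assms(2) by (simp only: power_add power_mult) (simp add: primitive_root_of_unity_def)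
  finally have "\<epsilon> ^ k = \<epsilon> ^ (k mod n)" .
  moreover have "k mod n < n" using assms(1) by simp
  ultimately show ?thesis
    using assms(2) by (cases "k mod n = 0") (auto simp: primitive_root_of_unity_def dvd_eq_mod_eq_0)
qed

text \<open>Replacing \<open>z\<close> by \<open>\<epsilon> * z\<close> does not change
  \<open>z ^ n\<close>, so \<open>c k i j * (\<epsilon> ^ k - 1) = 0\<close>. Hence only exponents
  \<open>k\<close> divisible by \<open>n\<close> survive, and these give powers of
  \<open>z ^ n\<close>.\<close>

lemma polyfun3_in_power:
  fixes f :: "complex \<Rightarrow> complex \<Rightarrow> complex \<Rightarrow> complex"
    and c :: "nat \<Rightarrow> nat \<Rightarrow> nat \<Rightarrow> int"
  assumes "n > 0" and prim: "primitive_root_of_unity n \<epsilon>" and "root_branch n \<rho>"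
    and f: "\<And>x y z. f (z ^ n) x y =
      (\<Sum>k\<le>N. \<Sum>i\<le>N. \<Sum>j\<le>N. of_int (c k i j) * z ^ k * x ^ i * y ^ j)"
    and supp: "\<And>k i j. c k i j \<noteq> 0 \<Longrightarrow> k \<le> N \<and> i \<le> N \<and> j \<le> N"
  shows "f z x y = (\<Sum>k\<le>N. \<Sum>i\<le>N. \<Sum>j\<le>N. of_int (c (n * k) i j) * z ^ k * x ^ i * y ^ j)"
proof -
  have dvd: "n dvd k" if "c k i j \<noteq> 0" for k i j
  proof -
    have "(\<Sum>k\<le>N. \<Sum>i\<le>N. \<Sum>j\<le>N. of_int (c k i j) * (\<epsilon> ^ k - 1) * z ^ k * x ^ i * y ^ j) = 0" for x y z
    proof -
      have "f ((\<epsilon> * z) ^ n) x y = f (z ^ n) x y"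
        using prim by (simp add: power_mult_distrib primitive_root_of_unity_def)
      then show ?thesis
        unfolding f by (simp add: power_mult_distrib algebra_simps sum_subtractf)
    qed
    from polyfun3_eq_0[OF this] have "of_int (c k i j) * (\<epsilon> ^ k - 1) = 0"
      using supp[OF that] by simp
    then show ?thesis
      using that primitive_root_of_unity_power_eq_1_iff[OF \<open>n > 0\<close> prim] by simp
  qed
  define w where "w = \<rho> z"
  have w: "w ^ n = z" using assms(3) by (simp add: w_def root_branch_def)
  define g where "g k = (\<Sum>i\<le>N. \<Sum>j\<le>N. of_int (c k i j) * w ^ k * x ^ i * y ^ j)" for k
  have g0: "g k = 0" if "\<not> (n dvd k \<and> k \<le> N)" for k
  proof -
    have "c k i j = 0" for i j using that dvd supp by blast
    then show ?thesis by (simp add: g_def)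
  qed
  have "f z x y = (\<Sum>k\<le>N. g k)" by (simp add: g_def f flip: w)
  \<comment> \<open>The image may contain multiples of \<open>n\<close> beyond \<open>N\<close>,
    where \<open>g\<close> vanishes. It contains every multiple \<open>n * k' \<le> N\<close>,
    because \<open>k' \<le> n * k'\<close>.\<close>
  also have "\<dots> = (\<Sum>k\<in>(*) n ` {..N}. g k)"
  proof (rule sum.mono_neutral_cong)
    fix k assume k: "k \<in> {..N} - (*) n ` {..N}"
    have "\<not> n dvd k"
    proof
      assume "n dvd k"
      then obtain k' where k': "k = n * k'" by (rule dvdE)
      have "k' \<le> n * k'" using \<open>n > 0\<close> by simp
      moreover have "n * k' \<le> N" using k unfolding k' by blast
      ultimately have "k' \<le> N" by (rule order_trans)
      then show False using k k' by blast
    qed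
    then show "g k = 0" using g0 by simp
  qed (use g0 in auto)
  also have "\<dots> = (\<Sum>k\<le>N. g (n * k))"
    using \<open>n > 0\<close> by (subst sum.reindex) (auto simp: inj_on_def)
  finally show ?thesis by (simp add: g_def power_mult w)
qed

section \<open>Properties of the polynomial\<close>

lemma map_mat_frobenius_mat:
  "comm_ring_hom h \<Longrightarrow> map_mat h (frobenius_mat n a) = frobenius_mat n (h a)"
proof -
  assume "comm_ring_hom h"
  then interpret comm_ring_hom h .
  show ?thesis by (rule eq_matI) (auto simp: frobenius_mat_def hom_distribs)
qed

lemma map_mat_kronecker_sum:
  assumes "comm_ring_hom h" and A: "A \<in> carrier_mat p p" and B: "B \<in> carrier_mat q q"
  shows "map_mat h (kronecker_sum A B) = kronecker_sum (map_mat h A) (map_mat h B)"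
proof -
  interpret comm_ring_hom h by fact
  have A': "map_mat h A \<in> carrier_mat p p" and B': "map_mat h B \<in> carrier_mat q q"
    using A B by auto
  note carrier_matD[OF kronecker_sum_carrier[OF A B], simp]
    carrier_matD[OF kronecker_sum_carrier[OF A' B'], simp]
  show ?thesis
  proof (rule eq_matI)
    fix i j assume "i < dim_row (kronecker_sum (map_mat h A) (map_mat h B))"
      and "j < dim_col (kronecker_sum (map_mat h A) (map_mat h B))"
    then have i: "i < p * q" and j: "j < p * q" by simp_all
    then show "map_mat h (kronecker_sum A B) $$ (i, j) =
        kronecker_sum (map_mat h A) (map_mat h B) $$ (i, j)"
      using A B div_mod_less[OF i] div_mod_less[OF j]
      by (simp add: kronecker_sum_index[OF A B i j] kronecker_sum_index[OF A' B' i j] hom_distribs)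
  qed simp_all
qed

text \<open>The eigenvalues of the two companion matrices are the \<open>\<epsilon> ^ r * a\<close>
  and the \<open>\<epsilon> ^ s * b\<close>, so both sides equal the double product with
  \<open>u = z\<close>.\<close>

lemma nv_poly_char_poly:
  assumes "n > 0" and "primitive_root_of_unity n \<epsilon>" and "root_branch n \<rho>"
  shows "nv_poly n \<epsilon> \<rho> (z ^ n) x y =
    poly (char_poly (kronecker_sum (frobenius_mat n ((-1) ^ (n + 1) * x))
                                   (frobenius_mat n ((-1) ^ (n + 1) * y)))) z"
proof -
  define a b where "a = \<rho> ((-1) ^ n * x)" and "b = \<rho> ((-1) ^ n * y)"
  have a: "a ^ n = (-1) ^ n * x" and b: "b ^ n = (-1) ^ n * y"
    using assms(3) by (simp_all add: a_def b_def root_branch_def)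
  have char_poly: "char_poly (frobenius_mat n ((-1) ^ (n + 1) * w)) =
      (\<Prod>e\<leftarrow>map (\<lambda>r. \<epsilon> ^ r * v) [1..<Suc n]. [:- e, 1:])" if "v ^ n = (-1) ^ n * w" for v w
  proof -
    \<comment> \<open>The sign is chosen so that
      \<open>(-1) ^ (n + 1) * w = - (v ^ n)\<close>.\<close>
    have "char_poly (frobenius_mat n ((-1) ^ (n + 1) * w)) = monom 1 n - [:v ^ n:]"
      by (simp add: char_poly_frobenius_mat[OF assms(1)] that)
    also have "\<dots> = (\<Prod>r\<in>{1..n}. [:- (\<epsilon> ^ r * v), 1:])"
      by (rule monom_minus_const_factorization[OF assms(1,2)])
    also have "\<dots> = (\<Prod>e\<leftarrow>map (\<lambda>r. \<epsilon> ^ r * v) [1..<Suc n]. [:- e, 1:])"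
      by (subst atLeastLessThanSuc_atLeastAtMost[symmetric], subst set_upt[symmetric],
          subst prod.distinct_set_conv_list) (simp_all add: comp_def del: upt_Suc)
    finally show ?thesis .
  qed
  have prod_list: "(\<Prod>r\<leftarrow>[1..<Suc n]. h r) = (\<Prod>r\<in>{1..n}. h r)" for h :: "nat \<Rightarrow> complex"
    by (subst atLeastLessThanSuc_atLeastAtMost[symmetric], subst set_upt[symmetric],
        subst prod.distinct_set_conv_list) (simp_all del: upt_Suc)
  have "poly (char_poly (kronecker_sum (frobenius_mat n ((-1) ^ (n + 1) * x))
      (frobenius_mat n ((-1) ^ (n + 1) * y)))) z =
    (\<Prod>r\<in>{1..n}. \<Prod>s\<in>{1..n}. z - \<epsilon> ^ r * a - \<epsilon> ^ s * b)"
    by (subst char_poly_kronecker_sum[OF frobenius_mat_carrier frobenius_mat_carrier char_poly[OF a] char_poly[OF b]])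
      (simp_all add: poly_hom.hom_prod_list comp_def prod_list algebra_simps del: upt_Suc One_nat_def)
  also have "\<dots> = nv_poly n \<epsilon> \<rho> (z ^ n) x y"
    by (rule nv_poly_double_product[OF assms refl a b, symmetric])
  finally show ?thesis ..
qed

lemma homogeneous_nv_poly:
  assumes "n > 0" and "primitive_root_of_unity n \<epsilon>" and "root_branch n \<rho>"
  shows "homogeneous_int_poly3 n (nv_poly n \<epsilon> \<rho>)"
proof -
  define X Y :: "int poly poly" where "X = [:0, 1:]" and "Y = [:[:0, 1:]:]"
  \<comment> \<open>\<open>K\<close> is the generic matrix with indeterminates for \<open>x\<close>
    and \<open>y\<close>. Evaluation is a ring homomorphism and commutes with
    \<open>char_poly\<close>, so one family of integer coefficients serves all \<open>x\<close> and
    \<open>y\<close>.\<close>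
  define K where "K = kronecker_sum (frobenius_mat n ((-1) ^ (n + 1) * X))
    (frobenius_mat n ((-1) ^ (n + 1) * Y))"
  have K: "K \<in> carrier_mat (n * n) (n * n)" by (simp add: K_def)
  have eval: "nv_poly n \<epsilon> \<rho> (z ^ n) x y = poly (map_poly (eval_int_poly2 x y) (char_poly K)) z"
    for x y z
  proof -
    interpret comm_ring_hom "eval_int_poly2 x y" by (rule comm_ring_hom_eval_int_poly2)
    have "eval_int_poly2 x y X = x" and "eval_int_poly2 x y Y = y"
      by (simp_all add: X_def Y_def eval_int_poly2_def)
    then have "map_mat (eval_int_poly2 x y) K =
        kronecker_sum (frobenius_mat n ((-1) ^ (n + 1) * x)) (frobenius_mat n ((-1) ^ (n + 1) * y))"
      by (simp add: K_def map_mat_kronecker_sum[OF comm_ring_hom_axioms, of _ n _ n]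
          map_mat_frobenius_mat[OF comm_ring_hom_axioms] hom_distribs)
    then show ?thesis
      by (simp add: nv_poly_char_poly[OF assms] flip: char_poly_hom[OF K])
  qed
  obtain c N where
    c: "\<And>x y z. poly (map_poly (eval_int_poly2 x y) (char_poly K)) z =
      (\<Sum>k\<le>N. \<Sum>i\<le>N. \<Sum>j\<le>N. of_int (c k i j) * z ^ k * x ^ i * y ^ j)"
    and supp: "\<And>k i j. c k i j \<noteq> 0 \<Longrightarrow> k \<le> N \<and> i \<le> N \<and> j \<le> N"
    by (rule int_poly3_expansion[of "char_poly K"]) (rule that)
  show ?thesis
  proof (rule homogeneous_int_poly3I)
    show "nv_poly n \<epsilon> \<rho> z x y =
        (\<Sum>k\<le>N. \<Sum>i\<le>N. \<Sum>j\<le>N. of_int (c (n * k) i j) * z ^ k * x ^ i * y ^ j)" for x y z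
      using eval c supp by (intro polyfun3_in_power[OF assms]) auto
    show "k \<le> N \<and> i \<le> N \<and> j \<le> N" if "c (n * k) i j \<noteq> 0" for k i j
      using supp[OF that] \<open>n > 0\<close> by (auto elim: order_trans[rotated])
    show "nv_poly n \<epsilon> \<rho> (2 * z) (2 * x) (2 * y) = 2 ^ n * nv_poly n \<epsilon> \<rho> z x y" for x y z
      by (rule nv_poly_scale[OF assms])
    \<comment> \<open>With this value every factor of \<open>nv_poly\<close> at
      \<open>(1, 0, 0)\<close> equals 1, which supplies the required nonzero value.\<close>
    have "\<rho> 0 = 0"
      using assms(1,3) by (metis power_eq_0_iff root_branch_def)
    then show "nv_poly n \<epsilon> \<rho> 1 0 0 \<noteq> 0"
      using assms(1) by (simp add: nv_poly_altdef power_0_left)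
  qed
qed

theorem proposition7:
  fixes n :: nat and \<epsilon> :: complex and \<rho> :: "complex \<Rightarrow> complex"
  assumes "n > 0"
    and "primitive_root_of_unity n \<epsilon>"
    and "root_branch n \<rho>"
  shows "symmetric3 (nv_poly n \<epsilon> \<rho>) \<and>
    (\<forall>x y z. nv_poly n \<epsilon> \<rho> (z ^ n) x y =
      poly (char_poly (kronecker_sum (frobenius_mat n ((-1) ^ (n + 1) * x))
                                     (frobenius_mat n ((-1) ^ (n + 1) * y)))) z) \<and>
    homogeneous_int_poly3 n (nv_poly n \<epsilon> \<rho>)"
  using symmetric3_nv_poly[OF assms] nv_poly_char_poly[OF assms] homogeneous_nv_poly[OF assms]
  by blast

end
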